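(* Let $B$ be a finite edge-clean bidirected graph rooted at $r$ and let $x\in V(B)\setminus\{r\}$. Then $$\lambda_B^{\mathrm{path}}(r,x)=\min\left\{\left|\delta_{r,B}^{\mathsf{path}}(X)\right| : x\in X\subseteq V(B)\setminus\{r\}\right\}.$$
   Context: A bidirected graph $B=(G,\sigma)$ is a loopless multigraph $G$ together with a map $\sigma$ assigning to each half-edge $(e,u)$ ($u$ an endpoint of the edge $e$) a sign $\sigma(e,u)\in\{+,-\}$. An oriented edge $\vec e$ is an edge $e$ with a choice of which endpoint is its tail and which its head; $\overleftarrow{e}$ is the opposite orientation. A trail is a sequence $v_0\vec e_1v_1\dots\vec e_\ell v_\ell$ in which the edges $e_i$ are pairwise distinct, $\vec e_i$ has tail $v_{i-1}$ and head $v_i$, and $\sigma(e_{i+1},v_i)=-\sigma(e_i,v_i)$ for $1\le i<\ell$; it is a $v_0$--$v_\ell$ trail. A path is a trail that does not repeat vertices. Two trails are edge-disjoint if they share no underlying edge. $B$ is rooted if it has a designated root vertex $r$. An $r$-trail is a trail starting in $r$ with no internal vertex equal to $r$. An $r$--$\vec e$ trail (path) is an $r$-trail (path starting in $r$) whose last oriented edge is $\vec e$. An edge $e$ is trail-undirectable if there are both an $r$--$\vec e$ trail and an $r$--$\overleftarrow{e}$ trail. $B$ is edge-clean if no trail-undirectable edge is incident with $r$ (equivalently, $r$ lies in no nontrivial connected component of the subgraph formed by the trail-undirectable edges). $\lambda_B^{\mathrm{path}}(v,w)$ is the maximum number of pairwise edge-disjoint $v$--$w$ paths in $B$. For $X\subseteq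 V(B)\setminus\{r\}$, $\delta_{r,B}^{\mathsf{path}}(X)$ is the set of edges $e\in E(B)$ having an orientation $\vec e$ whose head is in $X$, whose tail is not in $X$, and for which an $r$--$\vec e$ path exists. *)

theory Defs
  imports Main
begin

datatype sign = Plus | Minus

primrec opp :: "sign \<Rightarrow> sign" where
  "opp Plus = Minus"
| "opp Minus = Plus"

text \<open>Parallel edges are allowed: an edge is an abstract object with a set of two endpoints.
  The value \<open>sgn_of B e u\<close> is meaningful only if \<open>u\<close> is an endpoint of the edge \<open>e\<close>.\<close>

record ('v, 'e) bigraph =
  verts :: "'v set"
  edges :: "'e set"
  ends :: "'e \<Rightarrow> 'v set"
  sgn_of :: "'e \<Rightarrow> 'v \<Rightarrow> sign"

locale bidirected_graph =
  fixes B :: "('v, 'e) bigraph"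
  assumes ends_in_verts: "e \<in> edges B \<Longrightarrow> ends B e \<subseteq> verts B"
    and two_ends: "e \<in> edges B \<Longrightarrow> card (ends B e) = 2"

locale finite_bidirected_graph = bidirected_graph +
  assumes finite_verts: "finite (verts B)"
    and finite_edges: "finite (edges B)"

datatype ('v, 'e) oedge = OEdge (edge: 'e) (tail: 'v) (head: 'v)

definition oriented_edges :: "('v, 'e) bigraph \<Rightarrow> ('v, 'e) oedge set" where
  "oriented_edges B = {a. edge a \<in> edges B \<and> ends B (edge a) = {tail a, head a}}"

definition opposite :: "('v, 'e) oedge \<Rightarrow> ('v, 'e) oedge" where
  "opposite a = OEdge (edge a) (head a) (tail a)"

text \<open>The sequence \<open>v\<^sub>0 e\<^sub>1 v\<^sub>1 \<dots> e\<^sub>l v\<^sub>l\<close> is encoded by its first vertex \<open>v\<^sub>0\<close> and the list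
  of its oriented edges; \<open>seq_verts\<close> recovers the list \<open>v\<^sub>0, \<dots>, v\<^sub>l\<close>. Since list indices start
  at 0, \<open>e\<^sub>i\<close> is \<open>p ! (i - 1)\<close>.\<close>

definition seq_verts :: "'v \<Rightarrow> ('v, 'e) oedge list \<Rightarrow> 'v list" where
  "seq_verts v p = v # map head p"

definition trail :: "('v, 'e) bigraph \<Rightarrow> 'v \<Rightarrow> ('v, 'e) oedge list \<Rightarrow> 'v \<Rightarrow> bool" where
  "trail B v p w \<longleftrightarrow>
     v \<in> verts B \<and> set p \<subseteq> oriented_edges B \<and> distinct (map edge p) \<and>
     (\<forall>i < length p. tail (p ! i) = seq_verts v p ! i) \<and>
     (\<forall>i. Suc i < length p \<longrightarrow>
        sgn_of B (edge (p ! Suc i)) (head (p ! i)) = opp (sgn_of B (edge (p ! i)) (head (p ! i)))) \<and>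
     last (seq_verts v p) = w"

definition path :: "('v, 'e) bigraph \<Rightarrow> 'v \<Rightarrow> ('v, 'e) oedge list \<Rightarrow> 'v \<Rightarrow> bool" where
  "path B v p w \<longleftrightarrow> trail B v p w \<and> distinct (seq_verts v p)"

definition edge_disjoint :: "('v, 'e) oedge list \<Rightarrow> ('v, 'e) oedge list \<Rightarrow> bool" where
  "edge_disjoint p q \<longleftrightarrow> edge ` set p \<inter> edge ` set q = {}"

text \<open>The internal vertices \<open>v\<^sub>1, \<dots>, v\<^sub>l\<^sub>-\<^sub>1\<close> avoid the root; the last vertex may be the root.\<close>

definition root_trail :: "('v, 'e) bigraph \<Rightarrow> 'v \<Rightarrow> ('v, 'e) oedge list \<Rightarrow> bool" where
  "root_trail B r p \<longleftrightarrow> (\<exists>w. trail B r p w) \<and> r \<notin> set (butlast (tl (seq_verts r p)))"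

definition root_trail_to :: "('v, 'e) bigraph \<Rightarrow> 'v \<Rightarrow> ('v, 'e) oedge \<Rightarrow> ('v, 'e) oedge list \<Rightarrow> bool" where
  "root_trail_to B r a p \<longleftrightarrow> root_trail B r p \<and> p \<noteq> [] \<and> last p = a"

definition root_path_to :: "('v, 'e) bigraph \<Rightarrow> 'v \<Rightarrow> ('v, 'e) oedge \<Rightarrow> ('v, 'e) oedge list \<Rightarrow> bool" where
  "root_path_to B r a p \<longleftrightarrow> (\<exists>w. path B r p w) \<and> p \<noteq> [] \<and> last p = a"

definition trail_undirectable :: "('v, 'e) bigraph \<Rightarrow> 'v \<Rightarrow> 'e \<Rightarrow> bool" where
  "trail_undirectable B r e \<longleftrightarrow>
     (\<exists>a \<in> oriented_edges B. edge a = e \<and>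
        (\<exists>p. root_trail_to B r a p) \<and> (\<exists>p. root_trail_to B r (opposite a) p))"

definition edge_clean :: "('v, 'e) bigraph \<Rightarrow> 'v \<Rightarrow> bool" where
  "edge_clean B r \<longleftrightarrow> (\<forall>e \<in> edges B. trail_undirectable B r e \<longrightarrow> r \<notin> ends B e)"

text \<open>The maximum exists whenever \<open>B\<close> is finite, as edges of a trail are distinct.\<close>

definition lambda_path :: "('v, 'e) bigraph \<Rightarrow> 'v \<Rightarrow> 'v \<Rightarrow> nat" where
  "lambda_path B v w =
     Max {card P | P. finite P \<and> P \<subseteq> {p. path B v p w} \<and> pairwise edge_disjoint P}"

definition delta_path :: "('v, 'e) bigraph \<Rightarrow> 'v \<Rightarrow> 'v set \<Rightarrow> 'e set" where
  "delta_path B r X =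
     {e \<in> edges B. \<exists>a \<in> oriented_edges B. edge a = e \<and> head a \<in> X \<and> tail a \<notin> X \<and>
        (\<exists>p. root_path_to B r a p)}"

end

theory Submission
  imports Defs
begin

text \<open>Contract every component of the graph formed by the undirectable edges. If an r-trail could
  arrive in a nontrivial component while avoiding one of its reachable directed entering edges \<open>b\<close>,
  rerouting would produce an r-trail traversing \<open>b\<close> backwards, making \<open>b\<close> undirectable. Hence all
  r-trails arriving in the component use \<open>b\<close>, so the entering edge is unique. Similarly all reachable
  edges entering a vertex outside these components have the same sign there. So signs impose no
  constraint outside the components, each nontrivial component is used by at most one of several
  edge-disjoint paths, and Menger's theorem for the digraph formed by the remaining edges that end
  an \<open>r\<close>-path lifts to the bidirected graph. A vertex \<open>x\<close> reached by no path from \<open>r\<close> is separated by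
  the set of all such vertices.\<close>

subsection \<open>Menger's theorem for arc-disjoint paths in digraphs\<close>

text \<open>The endpoint maps are parameters so that one notion serves a digraph, its residual
  digraph, and the contraction whose vertices are classes; arcs are abstract, so parallel arcs are
  allowed.\<close>

fun dwalk :: "('a \<Rightarrow> 'n) \<Rightarrow> ('a \<Rightarrow> 'n) \<Rightarrow> 'n \<Rightarrow> 'a list \<Rightarrow> 'n \<Rightarrow> bool" where
  "dwalk src tgt u [] v \<longleftrightarrow> u = v"
| "dwalk src tgt u (a # p) v \<longleftrightarrow> src a = u \<and> dwalk src tgt (tgt a) p v"

definition dpath :: "('a \<Rightarrow> 'n) \<Rightarrow> ('a \<Rightarrow> 'n) \<Rightarrow> 'n \<Rightarrow> 'a list \<Rightarrow> 'n \<Rightarrow> bool" where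
  "dpath src tgt u p v \<longleftrightarrow> dwalk src tgt u p v \<and> distinct (u # map tgt p)"

lemma dwalk_append:
  "dwalk src tgt u (p @ q) v \<longleftrightarrow> (\<exists>w. dwalk src tgt u p w \<and> dwalk src tgt w q v)"
  by (induction p arbitrary: u) auto

lemma dwalk_last: "dwalk src tgt u p v \<Longrightarrow> p \<noteq> [] \<Longrightarrow> tgt (last p) = v"
  by (induction p arbitrary: u) auto

text \<open>Where the next vertex already lies on the path, the path is cut back to the earlier
  visit instead of being extended.\<close>

lemma dpath_if_reachable:
  assumes "(u, v) \<in> {(src a, tgt a) | a. a \<in> A}\<^sup>*"
  shows "\<exists>p. set p \<subseteq> A \<and> dpath src tgt u p v"
  using assms
proof (induction rule: rtrancl_induct)
  case base
  have "set [] \<subseteq> A \<and> dpath src tgt u [] u" by (simp add: dpath_def)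
  then show ?case by blast
next
  case (step v w)
  then obtain p a where p: "set p \<subseteq> A" "dpath src tgt u p v" and a: "a \<in> A" "src a = v" "tgt a = w"
    by auto
  show ?case
  proof (cases "w \<in> set (u # map tgt p)")
    case False
    then have "set (p @ [a]) \<subseteq> A \<and> dpath src tgt u (p @ [a]) w"
      using p a by (auto simp: dpath_def dwalk_append)
    then show ?thesis by blast
  next
    case True
    then consider "w = u" | b where "b \<in> set p" "tgt b = w" by auto
    then show ?thesis
    proof cases
      case 1
      then have "set [] \<subseteq> A \<and> dpath src tgt u [] w" by (simp add: dpath_def)
      then show ?thesis by blast
    next
      case 2
      then obtain p1 p2 where "p = p1 @ b # p2" by (meson split_list)
      then have "set (p1 @ [b]) \<subseteq> A \<and> dpath src tgt u (p1 @ [b]) w"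
        using p 2 by (auto simp: dpath_def dwalk_append)
      then show ?thesis by blast
    qed
  qed
qed

text \<open>The net outflow at \<open>v\<close> when \<open>F\<close> is read as a 0-1 flow; it is
  integer-valued because it can be negative, as at a sink.\<close>

definition net :: "('a \<Rightarrow> 'n) \<Rightarrow> ('a \<Rightarrow> 'n) \<Rightarrow> 'a set \<Rightarrow> 'n \<Rightarrow> int" where
  "net src tgt F v = (\<Sum>a\<in>F. of_bool (src a = v) - of_bool (tgt a = v))"

lemma net_insert:
  assumes "finite F" "a \<notin> F"
  shows "net src tgt (insert a F) v = net src tgt F v + of_bool (src a = v) - of_bool (tgt a = v)"
  using assms by (simp add: net_def)

lemma net_remove:
  assumes "finite F" "a \<in> F"
  shows "net src tgt (F - {a}) v = net src tgt F v - of_bool (src a = v) + of_bool (tgt a = v)"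
  using net_insert[of "F - {a}" a src tgt v] assms by (simp add: insert_absorb)

text \<open>After exchanging the sums, an arc with both ends in \<open>M\<close> cancels, so only
  arcs across the boundary of \<open>M\<close> count.\<close>

lemma sum_net:
  assumes "finite F" "finite M"
  shows "(\<Sum>v\<in>M. net src tgt F v) = (\<Sum>a\<in>F. of_bool (src a \<in> M) - of_bool (tgt a \<in> M))"
proof -
  have *: "(\<Sum>v\<in>M. of_bool (u = v)) = (of_bool (u \<in> M) :: int)" for u
    using assms(2) by (simp add: of_bool_def)
  have "(\<Sum>v\<in>M. net src tgt F v)
      = (\<Sum>a\<in>F. \<Sum>v\<in>M. of_bool (src a = v) - of_bool (tgt a = v))"
    unfolding net_def by (rule sum.swap)
  also have "\<dots> = (\<Sum>a\<in>F. of_bool (src a \<in> M) - of_bool (tgt a \<in> M))"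
    by (simp only: sum_subtractf *)
  finally show ?thesis .
qed

lemma net_remove_walk:
  assumes "finite F" "set p \<subseteq> F" "distinct p" "dwalk src tgt u p v"
  shows "net src tgt (F - set p) w = net src tgt F w - of_bool (u = w) + of_bool (v = w)"
  using assms
proof (induction p arbitrary: u F)
  case Nil
  then show ?case by simp
next
  case (Cons a p)
  have "F - set (a # p) = (F - {a}) - set p" by auto
  moreover have "net src tgt ((F - {a}) - set p) w
      = net src tgt (F - {a}) w - of_bool (tgt a = w) + of_bool (v = w)"
    using Cons.prems by (intro Cons.IH) auto
  ultimately show ?case using Cons.prems by (simp add: net_remove)
qed

text \<open>A residual step \<open>(a, True)\<close> adds the arc \<open>a\<close> to the flow, \<open>(a, False)\<close> removes it and is
  traversed against the direction of \<open>a\<close>.\<close>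

definition residual :: "'a set \<Rightarrow> 'a set \<Rightarrow> ('a \<times> bool) set" where
  "residual A F = {(a, True) | a. a \<in> A - F} \<union> {(a, False) | a. a \<in> F}"

definition res_src :: "('a \<Rightarrow> 'n) \<Rightarrow> ('a \<Rightarrow> 'n) \<Rightarrow> 'a \<times> bool \<Rightarrow> 'n" where
  "res_src src tgt b = (if snd b then src (fst b) else tgt (fst b))"

text \<open>Each step toggles one arc. As no arc occurs twice on the walk, the remaining steps stay
  residual for the toggled set.\<close>

lemma net_augment:
  assumes "finite A" "F \<subseteq> A" "set p \<subseteq> residual A F" "distinct (map fst p)"
    "dwalk (res_src src tgt) (res_src tgt src) u p v"
  shows "\<exists>F'\<subseteq>A. \<forall>w. net src tgt F' w = net src tgt F w + of_bool (u = w) - of_bool (v = w)"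
  using assms
proof (induction p arbitrary: u F)
  case Nil
  then show ?case by auto
next
  case (Cons b p)
  obtain a d where b: "b = (a, d)" by fastforce
  define F1 where "F1 = (if d then insert a F else F - {a})"
  have "finite F" using Cons.prems finite_subset by blast
  have b_res: "b \<in> residual A F" using Cons.prems(3) by simp
  have F1: "F1 \<subseteq> A" using b_res Cons.prems(2) b by (auto simp: residual_def F1_def)
  have "set p \<subseteq> residual A F1"
  proof
    fix c assume c: "c \<in> set p"
    have ne: "fst c \<noteq> a" using c Cons.prems(4) b by force
    have "c \<in> residual A F" using c Cons.prems(3) by auto
    then show "c \<in> residual A F1"
      using ne by (cases c) (auto simp: residual_def F1_def)
  qed
  moreover have "dwalk (res_src src tgt) (res_src tgt src) (res_src tgt src b) p v"
    and u: "res_src src tgt b = u" and "distinct (map fst p)"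
    using Cons.prems by simp_all
  ultimately obtain F' where F': "F' \<subseteq> A" "\<forall>w. net src tgt F' w
      = net src tgt F1 w + of_bool (res_src tgt src b = w) - of_bool (v = w)"
    using Cons.IH[OF assms(1) F1] by metis
  have "net src tgt F1 w
      = net src tgt F w + of_bool (u = w) - of_bool (res_src tgt src b = w)" for w
  proof (cases d)
    case True
    then have "a \<notin> F" using b_res b by (auto simp: residual_def)
    then show ?thesis
      using True u \<open>finite F\<close> b by (simp add: F1_def net_insert res_src_def)
  next
    case False
    then have "a \<in> F" using b_res b by (auto simp: residual_def)
    then show ?thesis
      using False u \<open>finite F\<close> b by (simp add: F1_def net_remove res_src_def)
  qed
  then show ?case using F' by (intro exI[of _ F']) simp
qed

text \<open>If \<open>t\<close> were unreachable from \<open>s\<close> inside \<open>F\<close>, no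
  arc of \<open>F\<close> would leave the reachable set, so its total net outflow would be at most
  0, against the positive value at \<open>s\<close>. Removing a path from \<open>s\<close> to
  \<open>t\<close> lowers the value by one and keeps the other vertices balanced.\<close>

lemma flow_decomposition:
  fixes src tgt :: "'a \<Rightarrow> 'n"
  assumes "finite F" "s \<noteq> t" "\<And>v. v \<noteq> s \<Longrightarrow> v \<noteq> t \<Longrightarrow> net src tgt F v = 0"
    "net src tgt F s = int k"
  shows "\<exists>P. finite P \<and> card P = k \<and> (\<forall>p\<in>P. set p \<subseteq> F \<and> dpath src tgt s p t)
    \<and> pairwise (\<lambda>p q. set p \<inter> set q = {}) P"
  using assms
proof (induction k arbitrary: F)
  case 0
  show ?case by (intro exI[of _ "{}"]) simp
next
  case (Suc k)
  define S where "S = {(src a, tgt a) | a. a \<in> F}\<^sup>* `` {s}"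
  \<comment> \<open>The vertex type may be infinite; \<open>M\<close> is a finite part of
    \<open>S\<close> containing all endpoints that matter for the sums.\<close>
  define M where "M = S \<inter> ({s, t} \<union> src ` F \<union> tgt ` F)"
  have S_closed: "tgt a \<in> S" if "a \<in> F" "src a \<in> S" for a
    using that by (auto simp: S_def intro: rtrancl_into_rtrancl)
  have "t \<in> S"
  proof (rule ccontr)
    assume t: "t \<notin> S"
    have "s \<in> M" by (simp add: S_def M_def)
    have finM: "finite M" using Suc.prems(1) by (simp add: M_def)
    have "(\<Sum>v\<in>M. net src tgt F v) = net src tgt F s"
    proof -
      have "(\<Sum>v\<in>M. net src tgt F v) = net src tgt F s + (\<Sum>v\<in>M - {s}. net src tgt F v)"
        using finM \<open>s \<in> M\<close> by (rule sum.remove)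
      also have "(\<Sum>v\<in>M - {s}. net src tgt F v) = 0"
        using Suc.prems(3) t by (intro sum.neutral) (auto simp: M_def)
      finally show ?thesis by simp
    qed
    moreover have "(\<Sum>v\<in>M. net src tgt F v) \<le> 0"
      unfolding sum_net[OF Suc.prems(1) finM]
      by (rule sum_nonpos) (auto simp: M_def S_closed)
    ultimately show False using Suc.prems(4) by simp
  qed
  then obtain p where p: "set p \<subseteq> F" "dpath src tgt s p t"
    using dpath_if_reachable[of s t src tgt F] unfolding S_def by auto
  have "distinct p" using p(2) by (auto simp: dpath_def distinct_map)
  have net: "net src tgt (F - set p) w = net src tgt F w - of_bool (s = w) + of_bool (t = w)" for w
    using p(2) by (intro net_remove_walk[OF Suc.prems(1) p(1) \<open>distinct p\<close>]) (simp add: dpath_def)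
  obtain P where P: "finite P" "card P = k" "\<forall>q\<in>P. set q \<subseteq> F - set p \<and> dpath src tgt s q t"
    "pairwise (\<lambda>p q. set p \<inter> set q = {}) P"
    using Suc.IH[of "F - set p"] Suc.prems by (auto simp: net)
  \<comment> \<open>The paths in \<open>P\<close> avoid the arcs of \<open>p\<close>, so the
    nonempty \<open>p\<close> is a new member and the cardinality grows by one.\<close>
  have "p \<noteq> []" using p(2) Suc.prems(2) by (auto simp: dpath_def)
  then have "p \<notin> P" using P(3) by (cases p) auto
  then show ?case
    using P p by (intro exI[of _ "insert p P"]) (auto simp: pairwise_insert)
qed

text \<open>Max-flow min-cut with unit capacities: for a flow of maximum value, the complement of
  the set reachable in the residual digraph is a cut of that size, and the flow decomposes into that
  many paths.\<close>

theorem menger_arcs: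
  fixes src tgt :: "'a \<Rightarrow> 'n"
  assumes "finite A" "s \<noteq> t"
  shows "\<exists>P X. finite P \<and> (\<forall>p\<in>P. set p \<subseteq> A \<and> dpath src tgt s p t)
    \<and> pairwise (\<lambda>p q. set p \<inter> set q = {}) P
    \<and> t \<in> X \<and> s \<notin> X \<and> card {a \<in> A. src a \<notin> X \<and> tgt a \<in> X} = card P"
proof -
  define flow where "flow F \<longleftrightarrow> F \<subseteq> A \<and> (\<forall>v. v \<noteq> s \<longrightarrow> v \<noteq> t \<longrightarrow> net src tgt F v = 0)" for F
  let ?N = "(\<lambda>F. net src tgt F s) ` {F. flow F}"
  have "{F. flow F} \<subseteq> Pow A" by (auto simp: flow_def)
  then have fin: "finite ?N" using assms(1) by (meson finite_Pow_iff finite_imageI finite_subset)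
  have "flow {}" by (simp add: flow_def net_def)
  then have "Max ?N \<in> ?N" using fin by (intro Max_in) auto
  then obtain F where F: "flow F" "net src tgt F s = Max ?N" by auto
  have F_max: "net src tgt F' s \<le> net src tgt F s" if "flow F'" for F'
    unfolding F(2) using that fin by (intro Max_ge) auto
  have FA: "F \<subseteq> A" and finF: "finite F" and bal: "\<And>v. v \<noteq> s \<Longrightarrow> v \<noteq> t \<Longrightarrow> net src tgt F v = 0"
    using F(1) finite_subset[OF _ assms(1)] by (auto simp: flow_def)
  define S where "S = {(res_src src tgt b, res_src tgt src b) | b. b \<in> residual A F}\<^sup>* `` {s}"
  have S_closed: "res_src tgt src b \<in> S" if b: "b \<in> residual A F" "res_src src tgt b \<in> S" for b
  proof -
    have "(res_src src tgt b, res_src tgt src b)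
        \<in> {(res_src src tgt b, res_src tgt src b) | b. b \<in> residual A F}" using b(1) by blast
    then show ?thesis using b(2) unfolding S_def by (meson Image_singleton_iff rtrancl_into_rtrancl)
  qed
  have fwd: "a \<in> F" if "a \<in> A" "src a \<in> S" "tgt a \<notin> S" for a
    using S_closed[of "(a, True)"] that by (auto simp: residual_def res_src_def)
  have bwd: "src a \<in> S" if "a \<in> F" "tgt a \<in> S" for a
    using S_closed[of "(a, False)"] that by (auto simp: residual_def res_src_def)
  have "t \<notin> S"
  proof
    assume "t \<in> S"
    then obtain p where p: "set p \<subseteq> residual A F" "dpath (res_src src tgt) (res_src tgt src) s p t"
      using dpath_if_reachable[of s t "res_src src tgt" "res_src tgt src" "residual A F"]
      unfolding S_def by auto
    \<comment> \<open>Each arc is residual in one direction only, so a residual path toggles no arc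
      twice.\<close>
    have "inj_on fst (residual A F)"
      by (auto simp: residual_def inj_on_def)
    then have "distinct (map fst p)"
      using p by (auto simp: dpath_def distinct_map intro: inj_on_subset)
    moreover have "dwalk (res_src src tgt) (res_src tgt src) s p t"
      using p(2) by (simp add: dpath_def)
    ultimately obtain F' where F': "F' \<subseteq> A"
      "\<And>w. net src tgt F' w = net src tgt F w + of_bool (s = w) - of_bool (t = w)"
      using net_augment[OF assms(1) FA p(1), of src tgt s t] by auto
    then have "flow F'" using bal by (simp add: flow_def)
    then show False using F_max[of F'] F'(2)[of s] assms(2) by simp
  qed
  define M where "M = S \<inter> ({s, t} \<union> src ` A \<union> tgt ` A)"
  have finM: "finite M" using assms(1) by (simp add: M_def)
  have "s \<in> S" by (simp add: S_def)
  let ?C = "{a \<in> A. src a \<in> S \<and> tgt a \<notin> S}"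
  have "net src tgt F s = (\<Sum>v\<in>M. net src tgt F v)"
  proof -
    have "s \<in> M" using \<open>s \<in> S\<close> by (simp add: M_def)
    then have "(\<Sum>v\<in>M. net src tgt F v) = net src tgt F s + (\<Sum>v\<in>M - {s}. net src tgt F v)"
      using finM by (intro sum.remove)
    also have "(\<Sum>v\<in>M - {s}. net src tgt F v) = 0"
      using bal \<open>t \<notin> S\<close> by (intro sum.neutral) (auto simp: M_def)
    finally show ?thesis by simp
  qed
  also have "\<dots> = (\<Sum>a\<in>F. of_bool (src a \<in> M) - of_bool (tgt a \<in> M))"
    using finF finM by (rule sum_net)
  \<comment> \<open>By \<open>bwd\<close> no flow arc enters \<open>S\<close> from outside, so the
    only nonzero terms come from arcs leaving \<open>S\<close>.\<close>
  also have "\<dots> = (\<Sum>a\<in>F. of_bool (a \<in> ?C))"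
    using FA bwd by (intro sum.cong) (auto simp: M_def)
  also have "\<dots> = int (card (F \<inter> ?C))"
    using finF by (simp add: of_bool_def sum.If_cases Int_def)
  also have "F \<inter> ?C = ?C" using fwd by auto
  finally have val: "net src tgt F s = int (card ?C)" .
  obtain P where P: "finite P" "card P = card ?C" "\<forall>p\<in>P. set p \<subseteq> F \<and> dpath src tgt s p t"
    "pairwise (\<lambda>p q. set p \<inter> set q = {}) P"
    using flow_decomposition[OF finF assms(2) bal val] by auto
  have "card {a \<in> A. src a \<notin> - S \<and> tgt a \<in> - S} = card P"
    unfolding P(2) by simp
  moreover have "\<forall>p\<in>P. set p \<subseteq> A \<and> dpath src tgt s p t" using P(3) FA by blast
  moreover have "t \<in> - S" "s \<notin> - S" using \<open>s \<in> S\<close> \<open>t \<notin> S\<close> by simp_all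
  ultimately show ?thesis using P(1,4) by blast
qed

subsection \<open>Root trails and rerouting\<close>

locale rooted_bigraph = finite_bidirected_graph B for B :: "('v, 'e) bigraph" +
  fixes r :: 'v
  assumes root: "r \<in> verts B"
begin

abbreviation OE :: "('v, 'e) oedge set" where "OE \<equiv> oriented_edges B"

definition link :: "('v, 'e) oedge \<Rightarrow> ('v, 'e) oedge \<Rightarrow> bool" where
  "link a b \<longleftrightarrow> head a = tail b \<and> sgn_of B (edge b) (head a) = opp (sgn_of B (edge a) (head a))"

lemma opp_opp [simp]: "opp (opp s) = s"
  by (cases s) auto

lemma opp_eq_opp_iff [simp]: "opp s = opp s' \<longleftrightarrow> s = s'"
  by (cases s; cases s') auto

lemma eq_opp_iff: "s \<noteq> s' \<longleftrightarrow> s' = opp s"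
  by (cases s; cases s') auto

lemma opposite_simps [simp]:
  "edge (opposite a) = edge a" "tail (opposite a) = head a" "head (opposite a) = tail a"
  "opposite (opposite a) = a" "opposite a \<in> OE \<longleftrightarrow> a \<in> OE"
  by (simp_all add: opposite_def oriented_edges_def doubleton_eq_iff insert_commute[of "head a" "tail a"])

lemma link_opposite: "link (opposite b) (opposite a) \<longleftrightarrow> link a b"
  by (auto simp: link_def)

lemma oedge_cases:
  assumes "a \<in> OE" "b \<in> OE" "edge a = edge b"
  shows "a = b \<or> a = opposite b"
  using assms by (cases a; cases b) (auto simp: oriented_edges_def opposite_def doubleton_eq_iff)

lemma oedge_ends: "a \<in> OE \<Longrightarrow> ends B (edge a) = {tail a, head a}"
  and oedge_edge: "a \<in> OE \<Longrightarrow> edge a \<in> edges B"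
  by (auto simp: oriented_edges_def)

lemma tail_neq_head: "a \<in> OE \<Longrightarrow> tail a \<noteq> head a"
  using two_ends[of "edge a"] by (auto simp: oriented_edges_def)

lemma head_in_verts: "a \<in> OE \<Longrightarrow> head a \<in> verts B"
  using ends_in_verts[of "edge a"] by (auto simp: oriented_edges_def)

text \<open>A segment is a trail without initial vertex that avoids \<open>r\<close> internally; in contrast to
  root trails this notion is invariant under reversal.\<close>

definition segment :: "('v, 'e) oedge list \<Rightarrow> bool" where
  "segment p \<longleftrightarrow> set p \<subseteq> OE \<and> successively link p \<and> distinct (map edge p)
    \<and> (\<forall>a\<in>set (butlast p). head a \<noteq> r)"

definition rtrail :: "('v, 'e) oedge list \<Rightarrow> bool" where
  "rtrail p \<longleftrightarrow> p \<noteq> [] \<and> segment p \<and> tail (hd p) = r"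

definition rpath :: "('v, 'e) oedge list \<Rightarrow> bool" where
  "rpath p \<longleftrightarrow> rtrail p \<and> distinct (r # map head p)"

definition reach :: "('v, 'e) oedge \<Rightarrow> bool" where
  "reach a \<longleftrightarrow> (\<exists>p. rtrail p \<and> last p = a)"

text \<open>Turns the indexed conditions into \<open>successively link\<close>, which is compatible
  with appending and reversing.\<close>

lemma trail_iff:
  assumes "p \<noteq> []"
  shows "trail B r p w \<longleftrightarrow> set p \<subseteq> OE \<and> successively link p \<and> distinct (map edge p)
    \<and> tail (hd p) = r \<and> head (last p) = w"
proof -
  have "(\<forall>i < length p. tail (p ! i) = (r # map head p) ! i)
    \<longleftrightarrow> tail (hd p) = r \<and> (\<forall>i. Suc i < length p \<longrightarrow> head (p ! i) = tail (p ! Suc i))" (is "?L \<longleftrightarrow> ?R")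
  proof
    assume L: ?L
    have "head (p ! i) = tail (p ! Suc i)" if "Suc i < length p" for i
      using L[rule_format, of "Suc i"] that by simp
    then show ?R using L[rule_format, of 0] assms by (simp add: hd_conv_nth)
  next
    assume R: ?R
    show ?L
    proof (intro allI impI)
      fix i assume "i < length p"
      then show "tail (p ! i) = (r # map head p) ! i"
        using R assms by (cases i) (simp_all add: hd_conv_nth)
    qed
  qed
  moreover have "last (seq_verts r p) = w \<longleftrightarrow> head (last p) = w"
    using assms by (simp add: seq_verts_def last_map)
  moreover have "successively link p \<longleftrightarrow> (\<forall>i. Suc i < length p \<longrightarrow> head (p ! i) = tail (p ! Suc i)) \<and>
    (\<forall>i. Suc i < length p \<longrightarrow>
       sgn_of B (edge (p ! Suc i)) (head (p ! i)) = opp (sgn_of B (edge (p ! i)) (head (p ! i))))"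
    unfolding successively_conv_nth link_def by blast
  ultimately show ?thesis
    using root unfolding trail_def seq_verts_def by blast
qed

lemma rtrail_iff_root_trail: "root_trail_to B r a p \<longleftrightarrow> rtrail p \<and> last p = a"
proof (cases "p = []")
  case False
  have "r \<notin> set (butlast (tl (seq_verts r p))) \<longleftrightarrow> (\<forall>a\<in>set (butlast p). head a \<noteq> r)"
    by (auto simp: seq_verts_def map_butlast[symmetric])
  then show ?thesis
    using False by (auto simp: root_trail_to_def root_trail_def trail_iff rtrail_def segment_def)
qed (simp add: root_trail_to_def rtrail_def)

lemma rpath_iff:
  assumes "p \<noteq> []"
  shows "path B r p w \<longleftrightarrow> rpath p \<and> head (last p) = w"
proof -
  \<comment> \<open>A path never returns to its first vertex, so a nonempty path from
    \<open>r\<close> is an \<open>r\<close>-trail.\<close>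
  have "\<forall>a\<in>set (butlast p). head a \<noteq> r" if "distinct (r # map head p)"
  proof
    fix a assume "a \<in> set (butlast p)"
    then have "a \<in> set p" by (rule in_set_butlastD)
    then show "head a \<noteq> r" using that by auto
  qed
  then show ?thesis
    using assms unfolding path_def trail_iff[OF assms] rpath_def rtrail_def segment_def seq_verts_def
    by blast
qed

lemma rpath_iff_root_path: "root_path_to B r a p \<longleftrightarrow> rpath p \<and> last p = a"
  by (cases "p = []") (auto simp: root_path_to_def rpath_iff rpath_def rtrail_def)

text \<open>An edge has just two orientations and the condition is symmetric in them, so the
  orientation in the definition may be fixed.\<close>

lemma undirectable_iff:
  assumes "a \<in> OE"
  shows "trail_undirectable B r (edge a) \<longleftrightarrow> reach a \<and> reach (opposite a)"
proof -
  have "trail_undirectable B r (edge a) \<longleftrightarrow>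
    (\<exists>b\<in>OE. edge b = edge a \<and> reach b \<and> reach (opposite b))"
    by (auto simp: trail_undirectable_def rtrail_iff_root_trail reach_def)
  also have "\<dots> \<longleftrightarrow> reach a \<and> reach (opposite a)"
    using oedge_cases[OF _ assms] assms by fastforce
  finally show ?thesis .
qed

lemma segment_append:
  "segment (p @ q) \<longleftrightarrow> segment p \<and> segment q \<and> edge ` set p \<inter> edge ` set q = {}
    \<and> (p \<noteq> [] \<longrightarrow> q \<noteq> [] \<longrightarrow> link (last p) (hd q) \<and> head (last p) \<noteq> r)"
proof (cases "p = [] \<or> q = []")
  case False
  then have "set p = insert (last p) (set (butlast p))"
    by (metis append_butlast_last_id list.simps(15) rotate1.simps(2) set_rotate1)
  with False show ?thesis
    by (auto simp: segment_def successively_append_iff butlast_append)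
qed (auto simp: segment_def)

lemma segment_single [simp]: "segment [a] \<longleftrightarrow> a \<in> OE"
  by (auto simp: segment_def)

lemma segment_Nil [simp]: "segment []"
  by (simp add: segment_def)

lemma segment_Cons:
  "segment (a # q) \<longleftrightarrow> a \<in> OE \<and> segment q \<and> edge a \<notin> edge ` set q
    \<and> (q \<noteq> [] \<longrightarrow> link a (hd q) \<and> head a \<noteq> r)"
  using segment_append[of "[a]" q] by auto

definition reversed :: "('v, 'e) oedge list \<Rightarrow> ('v, 'e) oedge list" where
  "reversed p = rev (map opposite p)"

lemma reversed_simps [simp]:
  "reversed [] = []" "reversed (p @ q) = reversed q @ reversed p"
  "reversed (a # p) = reversed p @ [opposite a]" "edge ` set (reversed p) = edge ` set p"
  "reversed p = [] \<longleftrightarrow> p = []"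
  by (auto simp: reversed_def image_image)

lemma last_reversed: "p \<noteq> [] \<Longrightarrow> last (reversed p) = opposite (hd p)"
  and hd_reversed: "p \<noteq> [] \<Longrightarrow> hd (reversed p) = opposite (last p)"
  by (auto simp: reversed_def last_rev hd_rev hd_map last_map)

lemma segment_reversed:
  assumes "segment p"
  shows "segment (reversed p)"
  using assms
proof (induction p)
  case (Cons a p)
  then show ?case
    by (auto simp: segment_Cons segment_append last_reversed link_opposite)
       (auto simp: link_def)
qed simp

lemma rtrail_append:
  assumes "p \<noteq> []"
  shows "rtrail (p @ q) \<longleftrightarrow> rtrail p \<and> segment q \<and> edge ` set p \<inter> edge ` set q = {}
    \<and> (q \<noteq> [] \<longrightarrow> link (last p) (hd q) \<and> head (last p) \<noteq> r)"
  using assms by (auto simp: rtrail_def segment_append)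

lemma rtrail_Cons_prefix: "rtrail (p @ a # q) \<Longrightarrow> rtrail (p @ [a])"
  using rtrail_append[of "p @ [a]" q] by simp

lemma rtrail_OE: "rtrail p \<Longrightarrow> a \<in> set p \<Longrightarrow> a \<in> OE"
  by (auto simp: rtrail_def segment_def)

lemma reach_OE: "reach a \<Longrightarrow> a \<in> OE"
  unfolding reach_def by (metis last_in_set rtrail_OE rtrail_def)

lemma reach_if_mem: "rtrail p \<Longrightarrow> a \<in> set p \<Longrightarrow> reach a"
  unfolding reach_def by (metis rtrail_Cons_prefix split_list snoc_eq_iff_butlast)

text \<open>Traversing the edge in the other direction would make a prefix of \<open>p\<close> reach
  \<open>opposite b\<close>.\<close>

lemma mem_if_edge_mem:
  assumes "rtrail p" "b \<in> OE" "edge b \<in> edge ` set p" "\<not> reach (opposite b)"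
  shows "b \<in> set p"
proof -
  obtain a where "a \<in> set p" "edge a = edge b" using assms(3) by auto
  then show ?thesis using oedge_cases[of a b] assms reach_if_mem rtrail_OE by metis
qed

lemma rtrail_tail_arrives:
  assumes "rtrail (p @ a # q)" "tail a \<noteq> r"
  shows "rtrail p \<and> link (last p) a"
proof -
  have "p \<noteq> []" using assms by (auto simp: rtrail_def)
  then show ?thesis using assms(1) by (simp add: rtrail_append)
qed

text \<open>Follow \<open>P\<close> until it meets the part of \<open>R\<close> after \<open>b\<close>. Continuing against the direction of
  \<open>R\<close> would traverse \<open>b\<close> backwards, so the continuation is in the direction of \<open>R\<close>.\<close>

lemma reroute:
  assumes P: "rtrail P" and R: "rtrail R" and b: "b \<in> set R" "edge b \<notin> edge ` set P"
    and nrev: "\<not> reach (opposite b)"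
    and z: "head (last P) = head (last R)" "head (last R) \<noteq> r"
    and sgn: "sgn_of B (edge (last P)) (head (last R)) = opp (sgn_of B (edge (last R)) (head (last R)))"
  shows "\<exists>P'. rtrail P' \<and> last P' = last R \<and> edge b \<notin> edge ` set P'
    \<and> edge ` set P' \<subseteq> edge ` set P \<union> edge ` set R"
proof -
  obtain R1 S where RS: "R = R1 @ b # S" using b(1) by (meson split_list)
  have seg_bS: "segment (b # S)" using R by (auto simp: RS rtrail_def segment_append)
  then have segS: "segment S" and bS: "edge b \<notin> edge ` set S" by (auto simp: segment_Cons)
  have Pne: "P \<noteq> []" using P by (simp add: rtrail_def)
  show ?thesis
  proof (cases "edge ` set P \<inter> edge ` set S = {}")
    case True
    \<comment> \<open>When \<open>P\<close> misses \<open>S\<close>, all of \<open>b # S\<close> can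
      be run backwards after \<open>P\<close>; the sign hypothesis is what the link at the common
      end vertex requires.\<close>
    have "segment (reversed (b # S))" using seg_bS by (rule segment_reversed)
    moreover have "link (last P) (hd (reversed (b # S)))"
      using z sgn by (subst hd_reversed) (auto simp: link_def RS)
    ultimately have "rtrail (P @ reversed (b # S))"
      using P Pne z True b(2) by (subst rtrail_append) auto
    then have "reach (opposite b)" unfolding reach_def
      by (intro exI[of _ "P @ reversed (b # S)"]) simp
    with nrev show ?thesis by simp
  next
    case False
    then have "\<exists>c\<in>set P. edge c \<in> edge ` set S" by auto
    \<comment> \<open>\<open>c\<close> is the first edge of \<open>P\<close> on \<open>S\<close>, so
      \<open>P1\<close> can be joined to pieces of \<open>S\<close> without repeating an
      edge.\<close>
    then obtain P1 c P2 where P1: "P = P1 @ c # P2" "edge c \<in> edge ` set S"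
      "\<forall>x\<in>set P1. edge x \<notin> edge ` set S"
      using split_list_first_prop[of P "\<lambda>c. edge c \<in> edge ` set S"] by metis
    then obtain d S1 S2 where S: "S = S1 @ d # S2" "edge d = edge c"
      by (metis (no_types, lifting) imageE split_list)
    have "d \<in> OE" "c \<in> OE" using segS P by (auto simp: segment_def S rtrail_def P1)
    then consider "c = d" | "c = opposite d" using oedge_cases S by metis
    then show ?thesis
    proof cases
      case 1
      have "segment ((P1 @ [c]) @ S2)"
        using P segS P1 S(2) unfolding 1 S(1)
        by (subst segment_append) (auto simp: rtrail_def segment_append segment_Cons)
      then have "rtrail (P1 @ [c] @ S2)"
        using P by (cases P1) (auto simp: rtrail_def P1(1))
      moreover have "last (P1 @ [c] @ S2) = last R" by (simp add: RS S 1)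
      moreover have "edge b \<notin> edge ` set (P1 @ [c] @ S2)" using b(2) bS by (auto simp: P1(1) S)
      moreover have "edge ` set (P1 @ [c] @ S2) \<subseteq> edge ` set P \<union> edge ` set R"
        by (auto simp: P1(1) RS S)
      ultimately show ?thesis by blast
    next
      case 2
      have "segment (reversed (b # S1 @ [d]))"
        using seg_bS by (intro segment_reversed) (auto simp: S segment_Cons segment_append hd_append)
      then have seg2: "segment (c # reversed (b # S1))" by (simp add: 2)
      have "segment (P1 @ [c])" using P by (auto simp: P1(1) rtrail_def segment_append segment_Cons)
      then have "segment (P1 @ c # reversed (b # S1))"
        using seg2 b(2) P1(3)
        by (subst segment_append) (auto simp: segment_append P1(1) S)
      then have "rtrail (P1 @ c # reversed (b # S1))"
        using P by (cases P1) (auto simp: rtrail_def P1(1))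
      then have "reach (opposite b)" unfolding reach_def
        by (intro exI[of _ "P1 @ c # reversed (b # S1)"]) simp
      with nrev show ?thesis by simp
    qed
  qed
qed

end

subsection \<open>Components of undirectable edges\<close>

locale clean_bigraph = rooted_bigraph +
  assumes clean: "edge_clean B r"
begin

abbreviation und :: "'b \<Rightarrow> bool" where "und \<equiv> trail_undirectable B r"

definition und_at :: "'a \<Rightarrow> bool" where
  "und_at v \<longleftrightarrow> (\<exists>a\<in>OE. und (edge a) \<and> tail a = v)"

text \<open>An equivalence relation, since \<open>OE\<close> contains both orientations of every
  edge. A vertex for which \<open>und_at\<close> fails is a class of its own.\<close>

definition conn :: "('a \<times> 'a) set" where
  "conn = {(tail a, head a) | a. a \<in> OE \<and> und (edge a)}\<^sup>*"

definition cls :: "'a \<Rightarrow> 'a set" where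
  "cls v = conn `` {v}"

lemma und_at_tail: "a \<in> OE \<Longrightarrow> und (edge a) \<Longrightarrow> und_at (tail a)"
  by (auto simp: und_at_def)

lemma und_at_head: "a \<in> OE \<Longrightarrow> und (edge a) \<Longrightarrow> und_at (head a)"
  using und_at_tail[of "opposite a"] by simp

text \<open>Edge-cleanness enters here; it makes \<open>r\<close> a class of its own.\<close>

lemma not_und_at_root: "\<not> und_at r"
  using clean by (auto simp: und_at_def edge_clean_def oedge_ends oedge_edge)

lemma conn_refl [simp]: "(v, v) \<in> conn"
  by (simp add: conn_def)

lemma conn_sym: "(u, v) \<in> conn \<Longrightarrow> (v, u) \<in> conn"
proof -
  have "sym {(tail a, head a) | a. a \<in> OE \<and> und (edge a)}"
  proof (rule symI)
    fix u v assume "(u, v) \<in> {(tail a, head a) | a. a \<in> OE \<and> und (edge a)}"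
    then obtain a where "a \<in> OE" "und (edge a)" "u = tail a" "v = head a" by auto
    then show "(v, u) \<in> {(tail a, head a) | a. a \<in> OE \<and> und (edge a)}"
      by (intro CollectI exI[of _ "opposite a"]) simp
  qed
  then have "sym conn" unfolding conn_def by (rule sym_rtrancl)
  then show "(u, v) \<in> conn \<Longrightarrow> (v, u) \<in> conn" by (rule symD)
qed

lemma conn_trans: "(u, v) \<in> conn \<Longrightarrow> (v, w) \<in> conn \<Longrightarrow> (u, w) \<in> conn"
  unfolding conn_def by (rule rtrancl_trans)

lemma conn_edge: "a \<in> OE \<Longrightarrow> und (edge a) \<Longrightarrow> (tail a, head a) \<in> conn"
  unfolding conn_def by blast

lemma cls_eq_iff: "cls u = cls v \<longleftrightarrow> (u, v) \<in> conn"
  unfolding cls_def using conn_sym conn_trans conn_refl by blast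

lemma conn_und_at:
  assumes "(u, v) \<in> conn" "u \<noteq> v"
  shows "und_at u"
  using assms unfolding conn_def
  by (induction rule: converse_rtrancl_induct) (auto intro: und_at_tail)

lemma conn_root: "(r, v) \<in> conn \<Longrightarrow> v = r"
  using conn_und_at not_und_at_root by blast

section \<open>Turning back along edges, and the entries of components\<close>

lemma rtrail_snoc:
  assumes "rtrail P" "c \<in> OE" "edge c \<notin> edge ` set P" "link (last P) c" "head (last P) \<noteq> r"
  shows "rtrail (P @ [c])"
  using assms by (subst rtrail_append) (auto simp: rtrail_def)

lemma reach_opposite:
  assumes "rtrail P" "b \<in> OE" "edge b \<notin> edge ` set P" "head (last P) = head b" "head b \<noteq> r"
    "sgn_of B (edge (last P)) (head b) = opp (sgn_of B (edge b) (head b))"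
  shows "reach (opposite b)"
proof -
  have "rtrail (P @ [opposite b])"
    using assms by (intro rtrail_snoc) (auto simp: link_def)
  then show ?thesis unfolding reach_def by (intro exI[of _ "P @ [opposite b]"]) simp
qed

lemma reach_step:
  assumes "reach a" "tail a \<noteq> r"
  shows "\<exists>P. rtrail (P @ [a]) \<and> rtrail P \<and> link (last P) a"
proof -
  obtain Q where Q: "rtrail Q" "last Q = a" using assms by (auto simp: reach_def)
  then have "Q = butlast Q @ [a]" by (metis append_butlast_last_id rtrail_def)
  then show ?thesis using rtrail_tail_arrives[of "butlast Q" a "[]"] Q assms by metis
qed

text \<open>Take an undirectable edge \<open>a\<close> at \<open>y\<close>. A trail ending with the
  orientation of \<open>a\<close> into \<open>y\<close> has one sign there; a trail ending with the
  other orientation, stripped of that last edge, has the opposite one.\<close>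

lemma und_at_both_signs:
  assumes "und_at y"
  shows "\<exists>Q. rtrail Q \<and> head (last Q) = y \<and> sgn_of B (edge (last Q)) y = s"
proof -
  obtain a where a: "a \<in> OE" "reach a" "reach (opposite a)" "tail a = y"
    using assms by (auto simp: und_at_def undirectable_iff)
  have "tail a \<noteq> r" using assms a not_und_at_root by auto
  show ?thesis
  proof (cases "s = sgn_of B (edge a) y")
    case True
    obtain Q where "rtrail Q" "last Q = opposite a" using a(3) by (auto simp: reach_def)
    then show ?thesis using True a by (intro exI[of _ Q]) simp
  next
    case False
    obtain Q where "rtrail Q" "link (last Q) a" using reach_step[OF a(2) \<open>tail a \<noteq> r\<close>] by auto
    then show ?thesis using False a
      by (intro exI[of _ Q]) (auto simp: link_def eq_opp_iff)
  qed
qed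

text \<open>A trail avoiding \<open>b\<close> could be rerouted so as to arrive at the head of \<open>b\<close> with the sign that
  allows traversing \<open>b\<close> backwards.\<close>

lemma entry_dominates:
  assumes b: "reach b" "\<not> und (edge b)" "und_at (head b)"
    and y: "(head b, y) \<in> conn" and P: "rtrail P" "head (last P) = y"
  shows "b \<in> set P"
proof -
  have bOE: "b \<in> OE" using b(1) by (rule reach_OE)
  have nrev: "\<not> reach (opposite b)" using b bOE by (simp add: undirectable_iff)
  have "head b \<noteq> r" using b(3) not_und_at_root by auto
  \<comment> \<open>Induction along the component from \<open>head b\<close>, over all trails at
    once: a trail ending at the new vertex is extended or cut back to the previous one.\<close>
  have "edge b \<in> edge ` set P"
    using y P unfolding conn_def
  proof (induction arbitrary: P rule: rtrancl_induct)
    case (base P)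
    show ?case
    proof (rule ccontr)
      assume bP: "edge b \<notin> edge ` set P"
      let ?s = "sgn_of B (edge b) (head b)"
      obtain R where R: "rtrail R" "head (last R) = head b"
        "sgn_of B (edge (last R)) (head b) = opp ?s"
        using und_at_both_signs[OF b(3)] by blast
      have no_back: "\<not> (rtrail Q \<and> edge b \<notin> edge ` set Q \<and> head (last Q) = head b
          \<and> sgn_of B (edge (last Q)) (head b) = opp ?s)" for Q
        using reach_opposite[of Q b] bOE nrev \<open>head b \<noteq> r\<close> by blast
      \<comment> \<open>\<open>R\<close> arrives ready to turn back into \<open>b\<close>, so it has
        already used \<open>b\<close>. \<open>P\<close> arrives with the other sign, so it can be
        rerouted into the last edge of \<open>R\<close> while avoiding \<open>b\<close>.\<close>
      have "edge b \<in> edge ` set R" using no_back[of R] R by blast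
      then have "b \<in> set R" using mem_if_edge_mem R bOE nrev by blast
      moreover have "sgn_of B (edge (last P)) (head b) = ?s"
        using no_back[of P] base bP eq_opp_iff by metis
      ultimately obtain P' where "rtrail P'" "last P' = last R" "edge b \<notin> edge ` set P'"
        using reroute[OF base(1) R(1) _ bP nrev] base R \<open>head b \<noteq> r\<close> by auto
      then show False using no_back[of P'] R by auto
    qed
  next
    case (step y z P)
    obtain a where a: "a \<in> OE" "und (edge a)" "tail a = y" "head a = z" using step.hyps by auto
    have "y \<noteq> r" "z \<noteq> r" using und_at_tail und_at_head a not_und_at_root by metis+
    have "edge a \<noteq> edge b" using a b by auto
    show ?case
    proof (rule ccontr)
      assume bP: "edge b \<notin> edge ` set P"
      \<comment> \<open>A trail using \<open>a\<close> in either direction visits \<open>y\<close>;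
        its part up to that visit would avoid \<open>b\<close>, against the induction
        hypothesis.\<close>
      have aP: "edge a \<notin> edge ` set P'"
        if P': "rtrail P'" "edge b \<notin> edge ` set P'" for P'
      proof
        assume "edge a \<in> edge ` set P'"
        then obtain d where d: "d \<in> set P'" "edge d = edge a" by auto
        then have "d = a \<or> d = opposite a" using oedge_cases[of d a] rtrail_OE P' a by blast
        then obtain c where c: "c \<in> set P'" "c = a \<or> c = opposite a" using d by blast
        then obtain P1 P2 where P12: "P' = P1 @ c # P2" by (meson split_list)
        have "\<exists>Q. rtrail Q \<and> head (last Q) = y \<and> set Q \<subseteq> set P'"
          using c(2)
        proof
          assume "c = a"
          then have "rtrail P1 \<and> link (last P1) c"
            using rtrail_tail_arrives P' P12 a \<open>y \<noteq> r\<close> by blast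
          then show ?thesis using \<open>c = a\<close> a P12 by (intro exI[of _ P1]) (auto simp: link_def)
        next
          assume "c = opposite a"
          then show ?thesis using rtrail_Cons_prefix[of P1 c P2] P' P12 a
            by (intro exI[of _ "P1 @ [c]"]) auto
        qed
        then show False using step.IH P' by blast
      qed
      \<comment> \<open>With this sign at \<open>z\<close> the trail could go on along
        \<open>opposite a\<close> to \<open>y\<close>, where the induction hypothesis
        applies.\<close>
      have snoc: False if P': "rtrail P'" "edge b \<notin> edge ` set P'" "head (last P') = z"
        "sgn_of B (edge (last P')) z = opp (sgn_of B (edge a) z)" for P'
      proof -
        have "rtrail (P' @ [opposite a])"
          using P' aP[OF P'(1,2)] a \<open>z \<noteq> r\<close> by (intro rtrail_snoc) (auto simp: link_def)
        then have "edge b \<in> edge ` set (P' @ [opposite a])" by (rule step.IH) (simp add: a)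
        then show False using P' \<open>edge a \<noteq> edge b\<close> by auto
      qed
      have s: "sgn_of B (edge (last P)) z = sgn_of B (edge a) z"
        using snoc[of P] step.prems bP eq_opp_iff by metis
      have "reach (opposite a)" using a by (simp add: undirectable_iff)
      \<comment> \<open>\<open>R\<close> ends at \<open>z\<close> with the sign that
        \<open>P\<close> lacks and contains \<open>b\<close>; rerouting \<open>P\<close> into the
        last edge of \<open>R\<close> gives a trail excluded by \<open>snoc\<close>.\<close>
      then obtain R where R: "rtrail (R @ [opposite a])" "rtrail R" "link (last R) (opposite a)"
        using reach_step[of "opposite a"] a \<open>z \<noteq> r\<close> by auto
      have "edge b \<in> edge ` set (R @ [opposite a])" by (rule step.IH[OF R(1)]) (simp add: a)
      then have "edge b \<in> edge ` set R" using \<open>edge a \<noteq> edge b\<close> by auto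
      then have "b \<in> set R" using mem_if_edge_mem R bOE nrev by blast
      moreover have R_sgn: "head (last R) = z" "sgn_of B (edge (last R)) z = opp (sgn_of B (edge a) z)"
        using R(3) a by (auto simp: link_def)
      ultimately obtain P' where "rtrail P'" "last P' = last R" "edge b \<notin> edge ` set P'"
        using reroute[OF step.prems(1) R(2) _ bP nrev] step.prems s \<open>z \<noteq> r\<close> by auto
      then show False using snoc[of P'] R_sgn by auto
    qed
  qed
  then show ?thesis using mem_if_edge_mem P bOE nrev by blast
qed

text \<open>Otherwise a trail ending with \<open>b\<close> would pass \<open>c\<close> before, and
  its prefix up to \<open>c\<close> would already contain \<open>b\<close>, so \<open>b\<close>
  would be repeated.\<close>

lemma entry_unique:
  assumes "reach b" "\<not> und (edge b)" "reach c" "\<not> und (edge c)" "und_at (head b)"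
    "(head b, head c) \<in> conn"
  shows "b = c"
proof (rule ccontr)
  assume "b \<noteq> c"
  have "und_at (head c)"
    using assms(5,6) conn_und_at conn_sym by metis
  obtain T where T: "rtrail T" "last T = b" using assms(1) by (auto simp: reach_def)
  then have "c \<in> set T"
    using entry_dominates[OF assms(3,4) \<open>und_at (head c)\<close>] conn_sym[OF assms(6)] by blast
  then obtain T1 T2 where T12: "T = T1 @ c # T2" by (meson split_list)
  then have "b \<in> set T2" using T \<open>b \<noteq> c\<close> by (auto split: if_splits)
  moreover have "b \<in> set (T1 @ [c])"
    using entry_dominates[OF assms(1,2,5,6), of "T1 @ [c]"] rtrail_Cons_prefix T T12 by auto
  ultimately show False using T \<open>b \<noteq> c\<close> by (auto simp: T12 rtrail_def segment_def)
qed

text \<open>With different signs, a trail ending with \<open>a\<close> must already have used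
  \<open>b\<close>, as it could otherwise turn back into \<open>b\<close>. Its prefix ending with
  \<open>b\<close> then turns back into \<open>a\<close>, making \<open>a\<close>
  undirectable.\<close>

lemma same_sign:
  assumes "reach a" "reach b" "head a = v" "head b = v" "v \<noteq> r" "\<not> und_at v"
  shows "sgn_of B (edge a) v = sgn_of B (edge b) v"
proof (rule ccontr)
  assume ne: "sgn_of B (edge a) v \<noteq> sgn_of B (edge b) v"
  have OE: "a \<in> OE" "b \<in> OE" using assms reach_OE by auto
  have nrev: "\<not> reach (opposite a)" "\<not> reach (opposite b)"
    using assms OE und_at_head undirectable_iff by metis+
  obtain T where T: "rtrail T" "last T = a" using assms(1) by (auto simp: reach_def)
  have "edge b \<in> edge ` set T"
    using reach_opposite[of T b] nrev OE assms ne T eq_opp_iff by metis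
  then have "b \<in> set T" using mem_if_edge_mem T OE nrev by blast
  then obtain T1 T2 where T12: "T = T1 @ b # T2" by (meson split_list)
  have "a \<noteq> b" using ne by auto
  then have "edge a \<in> edge ` set T2" using T by (auto simp: T12 split: if_splits)
  then have "edge a \<notin> edge ` set (T1 @ [b])" using T(1) by (auto simp: T12 rtrail_def segment_def)
  then have "reach (opposite a)"
    using reach_opposite[of "T1 @ [b]" a] rtrail_Cons_prefix[of T1 b T2] T OE assms ne T12
    by (simp add: eq_opp_iff)
  with nrev show False by simp
qed

lemma walk_enters:
  assumes "p \<noteq> []" "successively link p" "tail (hd p) \<notin> X" "head (last p) \<in> X"
  shows "\<exists>p1 g p2. p = p1 @ g # p2 \<and> tail g \<notin> X \<and> head g \<in> X"
  using assms
proof (induction p)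
  case (Cons a p)
  show ?case
  proof (cases "head a \<in> X")
    case True
    then show ?thesis using Cons.prems by (intro exI[of _ "[]"]) auto
  next
    case False
    then have "p \<noteq> []" using Cons.prems by auto
    then have "\<exists>p1 g p2. p = p1 @ g # p2 \<and> tail g \<notin> X \<and> head g \<in> X"
      using Cons False by (auto simp: successively_Cons link_def)
    then show ?thesis by (metis append_Cons)
  qed
qed simp

text \<open>The final piece \<open>q2\<close> of \<open>q\<close> links to \<open>b\<close> just as
  to \<open>c\<close> and stays in the component, so it can be grafted behind \<open>b\<close>. In a
  nontrivial component \<open>c\<close> is \<open>b\<close> by domination; otherwise
  \<open>q2\<close> is empty and the signs agree by \<open>same_sign\<close>.\<close>

lemma trail_split_at_entry:
  assumes b: "reach b" "\<not> und (edge b)" "head b \<noteq> r"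
    and q: "rtrail q" "(head b, head (last q)) \<in> conn"
  shows "\<exists>q1 c q2. q = q1 @ c # q2 \<and> head c = head b
    \<and> sgn_of B (edge c) (head b) = sgn_of B (edge b) (head b)
    \<and> (\<forall>d\<in>set q2. und_at (head b) \<and> (head b, tail d) \<in> conn \<and> (head b, head d) \<in> conn)"
proof (cases "und_at (head b)")
  case False
  then have "head (last q) = head b" using q conn_und_at by metis
  moreover have "reach (last q)" using q by (auto simp: reach_def)
  moreover have "q = butlast q @ last q # []" using q by (simp add: rtrail_def)
  ultimately show ?thesis using same_sign[of "last q" b] b False by (metis empty_iff list.set(1))
next
  case True
  then obtain q1 q2 where q12: "q = q1 @ b # q2"
    using entry_dominates[OF b(1,2) True q(2,1)] by (meson split_list)
  \<comment> \<open>Had \<open>q\<close> left the component after \<open>b\<close>, it would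
    re-enter by an edge that uniqueness identifies with \<open>b\<close>, repeating
    \<open>b\<close>.\<close>
  have heads: "(head b, head d) \<in> conn" if d_mem: "d \<in> set q2" for d
  proof (rule ccontr)
    assume d: "(head b, head d) \<notin> conn"
    obtain u w where uw: "q2 = u @ d # w" using d_mem by (meson split_list)
    then have "w \<noteq> []" using d q(2) q12 by auto
    moreover have "successively link (d # w)" using q(1)
      by (simp add: q12 uw rtrail_def segment_append segment_Cons segment_def successively_append_iff successively_Cons)
    moreover have "head (last w) \<in> cls (head b)" using q(2) \<open>w \<noteq> []\<close> by (simp add: q12 uw cls_def)
    ultimately obtain p1 g p2 where g: "w = p1 @ g # p2" "tail g \<notin> cls (head b)" "head g \<in> cls (head b)"
      using walk_enters[of w "cls (head b)"] d by (auto simp: successively_Cons link_def cls_def)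
    have "g \<in> set q" by (simp add: q12 uw g)
    then have "reach g" "g \<in> OE" using q reach_if_mem rtrail_OE by blast+
    moreover have "\<not> und (edge g)"
    proof
      assume "und (edge g)"
      then have "(head g, tail g) \<in> conn" using \<open>g \<in> OE\<close> conn_edge conn_sym by blast
      then show False using g conn_trans unfolding cls_def by blast
    qed
    moreover have "(head b, head g) \<in> conn" using g by (simp add: cls_def)
    ultimately have "b = g" using entry_unique b True by blast
    then show False using q(1) by (auto simp: q12 uw g rtrail_def segment_def)
  qed
  have "successively link (b # q2)" using q(1)
    by (simp add: q12 rtrail_def segment_def successively_append_iff)
  then have "(head b, tail d) \<in> conn" if d_mem: "d \<in> set q2" for d
  proof -
    obtain u w where uw: "q2 = u @ d # w" using d_mem by (meson split_list)
    show ?thesis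
    proof (cases "u = []")
      case True
      then show ?thesis using \<open>successively link (b # q2)\<close> by (simp add: uw link_def)
    next
      case False
      then have "link (last u) d"
        using \<open>successively link (b # q2)\<close> by (simp add: uw successively_Cons successively_append_iff)
      then show ?thesis using heads[of "last u"] False by (simp add: uw link_def)
    qed
  qed
  then show ?thesis using heads True q12 by blast
qed

subsection \<open>Lifting paths of the contracted digraph\<close>

lemma rpath_append_fst: "rpath (p @ q) \<Longrightarrow> p \<noteq> [] \<Longrightarrow> rpath p"
  by (auto simp: rpath_def rtrail_append)

lemma map_tail_snoc:
  assumes "successively link p" "p \<noteq> []"
  shows "map tail p @ [head (last p)] = tail (hd p) # map head p"
  using assms by (induction p rule: induct_list012) (auto simp: link_def)

text \<open>The vertices of a trail are its tails followed by its last head; this form suits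
  invariants about all vertices but the last.\<close>

lemma rpath_iff_tails:
  "rpath p \<longleftrightarrow> rtrail p \<and> distinct (map tail p) \<and> head (last p) \<notin> tail ` set p"
proof (cases "rtrail p")
  case True
  then have "r # map head p = map tail p @ [head (last p)]"
    using map_tail_snoc[of p] by (auto simp: rtrail_def segment_def)
  then show ?thesis using True by (auto simp: rpath_def)
qed (simp add: rpath_def)

lemma rpath_head_last: "rpath p \<Longrightarrow> head (last p) \<noteq> r"
  by (metis distinct.simps(2) imageI last_in_set list.set_map rpath_def rtrail_def)

lemma edge_ends_eq:
  assumes "a \<in> OE" "b \<in> OE" "edge a = edge b"
  shows "{tail a, head a} = {tail b, head b}"
  using assms by (simp add: oriented_edges_def)

text \<open>The final piece of \<open>q\<close> is grafted onto \<open>p\<close>. It stays in one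
  component, which by \<open>new\<close> meets \<open>p\<close> only at its end, so no edge or
  vertex repeats.\<close>

lemma rpath_extend_in_component:
  assumes p: "rpath p" "\<not> und (edge (last p))"
    and q: "rpath q" "(head (last p), head (last q)) \<in> conn"
    and new: "\<forall>d\<in>set p. (head (last p), tail d) \<notin> conn"
  shows "\<exists>q2. rpath (p @ q2) \<and> head (last (p @ q2)) = head (last q)
    \<and> sgn_of B (edge (last (p @ q2))) (head (last q)) = sgn_of B (edge (last q)) (head (last q))
    \<and> (\<forall>d\<in>set q2. und_at (head (last p)) \<and> (head (last p), tail d) \<in> conn
          \<and> (head (last p), head d) \<in> conn)"
proof -
  define b where "b = last p"
  have rp: "rtrail p" and rq: "rtrail q" using p q by (auto simp: rpath_def)
  have pne: "p \<noteq> []" using rp by (simp add: rtrail_def)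
  have "reach b" using rp by (auto simp: reach_def b_def)
  then obtain q1 c q2 where split: "q = q1 @ c # q2" "head c = head b"
    "sgn_of B (edge c) (head b) = sgn_of B (edge b) (head b)"
    "\<forall>d\<in>set q2. und_at (head b) \<and> (head b, tail d) \<in> conn \<and> (head b, head d) \<in> conn"
    using trail_split_at_entry[of b q] p q rq rpath_head_last[OF p(1)] unfolding b_def by metis
  show ?thesis
  proof (cases "q2 = []")
    case True
    then show ?thesis using p split by (intro exI[of _ "[]"]) (simp add: b_def)
  next
    case False
    have seg: "segment q2" "link c (hd q2)"
      using rq False by (auto simp: split(1) rtrail_def segment_append segment_Cons)
    have "edge ` set p \<inter> edge ` set q2 = {}"
    proof (rule ccontr)
      assume "edge ` set p \<inter> edge ` set q2 \<noteq> {}"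
      then obtain d d' where d: "d \<in> set p" "d' \<in> set q2" "edge d = edge d'" by auto
      then have "tail d \<in> {tail d', head d'}"
        using edge_ends_eq[of d d'] rtrail_OE[OF rp] rtrail_OE[OF rq] by (auto simp: split(1))
      then show False using d split(4) new b_def by auto
    qed
    moreover have "link (last p) (hd q2)" using seg(2) split(2,3) unfolding link_def b_def by metis
    ultimately have rt: "rtrail (p @ q2)"
      using rp pne seg rpath_head_last[OF p(1)] by (simp add: rtrail_append)
    have tails: "map tail (p @ q2) = map tail p @ butlast (head b # map head q2)"
      and heads: "head (last (p @ q2)) = last (head b # map head q2)"
    proof -
      have "map tail q2 @ [head (last q2)] = tail (hd q2) # map head q2"
        using seg(1) False by (intro map_tail_snoc) (auto simp: segment_def)
      moreover have "tail (hd q2) = head b" using seg(2) split by (simp add: link_def)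
      ultimately have "butlast (map tail q2 @ [head (last q2)]) = butlast (head b # map head q2)"
        by simp
      then show "map tail (p @ q2) = map tail p @ butlast (head b # map head q2)" by simp
      show "head (last (p @ q2)) = last (head b # map head q2)" using False by (simp add: last_map)
    qed
    \<comment> \<open>The grafted piece starts at \<open>head b\<close>, which is also
      \<open>head c\<close>, so its vertices are distinct because \<open>q\<close> is a
      path.\<close>
    have "distinct (map head (c # q2))" using q(1) by (simp add: split(1) rpath_def)
    then have dist: "distinct (head b # map head q2)" using split(2) by simp
    moreover have "set (head b # map head q2) \<inter> tail ` set p = {}"
      using split(4) new by (auto simp: b_def)
    ultimately have "distinct (map tail p @ (head b # map head q2))"
      using p(1) by (auto simp: rpath_iff_tails)
    then have "distinct ((map tail p @ butlast (head b # map head q2)) @ [last (head b # map head q2)])"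
      by (metis append.assoc append_butlast_last_id list.distinct(1))
    then have "distinct (map tail (p @ q2) @ [head (last (p @ q2))])"
      unfolding tails heads by simp
    then have "rpath (p @ q2)" using rt unfolding rpath_iff_tails by auto
    then show ?thesis using False split by (intro exI[of _ q2]) (auto simp: b_def)
  qed
qed

text \<open>Contracting the components of undirectable edges turns \<open>arcs\<close> into the arc set of a digraph,
  in which every nontrivial component has at most one incoming arc.\<close>

definition arcs :: "('a, 'b) oedge set" where
  "arcs = {a. (\<exists>p. rpath p \<and> last p = a) \<and> \<not> und (edge a)}"

lemma arcsD:
  assumes "a \<in> arcs"
  shows "a \<in> OE" "reach a" "\<not> und (edge a)" "head a \<noteq> r" "\<not> reach (opposite a)"
proof -
  obtain p where p: "rpath p" "last p = a" using assms by (auto simp: arcs_def)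
  then show "reach a" by (auto simp: reach_def rpath_def)
  then show "a \<in> OE" by (rule reach_OE)
  show "\<not> und (edge a)" using assms by (simp add: arcs_def)
  then show "\<not> reach (opposite a)" using \<open>a \<in> OE\<close> \<open>reach a\<close> by (simp add: undirectable_iff)
  show "head a \<noteq> r" using rpath_head_last p by blast
qed

text \<open>The root path \<open>p\<close> follows the path \<open>as\<close> of the contracted digraph and otherwise stays inside
  the nontrivial components visited by \<open>as\<close>.\<close>

definition lifts :: "('a, 'b) oedge list \<Rightarrow> ('a, 'b) oedge list \<Rightarrow> bool" where
  "lifts p as \<longleftrightarrow> (\<forall>d\<in>set p. d \<in> set as
    \<or> (\<exists>a\<in>set as. und_at (head a) \<and> (head a, tail d) \<in> conn \<and> (head a, head d) \<in> conn))"

abbreviation cpath :: "('a, 'b) oedge list \<Rightarrow> 'a set \<Rightarrow> bool" where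
  "cpath as v \<equiv> dpath (\<lambda>a. cls (tail a)) (\<lambda>a. cls (head a)) (cls r) as v"

text \<open>The clause about tails carries the induction: the class of the last head is none of
  those listed, so the lift meets that component only on arrival and can be continued inside
  it.\<close>

lemma lift_path:
  assumes "as \<noteq> []" "set as \<subseteq> arcs" "cpath as v"
  shows "\<exists>p. rpath p \<and> last p = last as \<and> lifts p as
    \<and> cls ` tail ` set p \<subseteq> insert (cls r) ((\<lambda>a. cls (head a)) ` set (butlast as))"
  using assms
proof (induction as arbitrary: v rule: rev_induct)
  case (snoc a as)
  have a: "a \<in> arcs" using snoc.prems by simp
  show ?case
  proof (cases "as = []")
    case True
    then have "cls (tail a) = cls r" using snoc.prems by (simp add: dpath_def)
    \<comment> \<open>The class of \<open>r\<close> is \<open>{r}\<close>, so an arc leaving it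
      starts at \<open>r\<close> itself.\<close>
    then have "tail a = r" using conn_root conn_sym by (simp add: cls_eq_iff)
    then have "rpath [a]" using arcsD[OF a] by (auto simp: rpath_def rtrail_def)
    then show ?thesis using True \<open>tail a = r\<close> by (intro exI[of _ "[a]"]) (simp add: lifts_def)
  next
    case False
    define b where "b = last as"
    have "b \<in> arcs" using snoc.prems False by (auto simp: b_def)
    have "as = butlast as @ [b]" using False by (simp add: b_def)
    obtain w where "dwalk (\<lambda>a. cls (tail a)) (\<lambda>a. cls (head a)) (cls r) as w"
      and w: "cls (tail a) = w"
      using snoc.prems by (auto simp: dpath_def dwalk_append)
    then have as: "cpath as w" and bw: "cls (head b) = w"
      using snoc.prems dwalk_last[where tgt = "\<lambda>a. cls (head a)", OF _ False] by (simp_all add: dpath_def b_def)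
    obtain p where p: "rpath p" "last p = b" "lifts p as"
      "cls ` tail ` set p \<subseteq> insert (cls r) ((\<lambda>a. cls (head a)) ` set (butlast as))"
      using snoc.IH[OF False _ as] snoc.prems by (auto simp: b_def)
    have dist: "distinct (cls r # map (\<lambda>a. cls (head a)) (butlast as @ [b, a]))"
      using snoc.prems \<open>as = butlast as @ [b]\<close>
      by (metis append.assoc append_Cons append_Nil dpath_def)
    have b_new: "\<forall>d\<in>set p. (head (last p), tail d) \<notin> conn"
    proof
      fix d assume "d \<in> set p"
      then have "cls (tail d) \<in> insert (cls r) ((\<lambda>a. cls (head a)) ` set (butlast as))"
        using p(4) by blast
      moreover have "cls (head b) \<notin> insert (cls r) ((\<lambda>a. cls (head a)) ` set (butlast as))"
        using dist by auto
      ultimately show "(head (last p), tail d) \<notin> conn" using p(2) cls_eq_iff by metis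
    qed
    \<comment> \<open>A root path ending with \<open>a\<close> shows how to cross the component:
      without \<open>a\<close> it ends at \<open>tail a\<close> with the sign that \<open>a\<close>
      needs, and its final piece is grafted onto \<open>p\<close>.\<close>
    obtain q0 where q0: "rpath q0" "last q0 = a" using a by (auto simp: arcs_def)
    then have q0': "q0 = butlast q0 @ [a]" by (metis append_butlast_last_id rpath_def rtrail_def)
    have ba: "(head b, tail a) \<in> conn" using bw w cls_eq_iff by metis
    have "tail a \<noteq> r" using ba conn_root conn_sym arcsD(4)[OF \<open>b \<in> arcs\<close>] by blast
    then have q: "rtrail (butlast q0)" "link (last (butlast q0)) a"
      using rtrail_tail_arrives[of "butlast q0" a "[]"] q0 q0' by (simp_all add: rpath_def)
    then have "rpath (butlast q0)"
      using rpath_append_fst[of "butlast q0" "[a]"] q0 q0' by (auto simp: rtrail_def)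
    moreover have "(head (last p), head (last (butlast q0))) \<in> conn"
      using q ba p(2) by (simp add: link_def)
    ultimately obtain q2 where q2: "rpath (p @ q2)" "head (last (p @ q2)) = tail a"
      "sgn_of B (edge (last (p @ q2))) (tail a) = sgn_of B (edge (last (butlast q0))) (tail a)"
      "\<forall>d\<in>set q2. und_at (head b) \<and> (head b, tail d) \<in> conn \<and> (head b, head d) \<in> conn"
      using rpath_extend_in_component[OF p(1) _ _ _ b_new, of "butlast q0"] p(2) q
        arcsD(3)[OF \<open>b \<in> arcs\<close>] by (auto simp: link_def)
    have tails: "cls ` tail ` set (p @ q2 @ [a])
        \<subseteq> insert (cls r) ((\<lambda>a. cls (head a)) ` set as)"
    proof -
      have "cls (tail d) = cls (head b)" if "d \<in> set (q2 @ [a])" for d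
        using that q2(4) ba conn_sym by (auto simp: cls_eq_iff)
      moreover have "cls (head b) \<in> (\<lambda>a. cls (head a)) ` set as"
        using False by (auto simp: b_def)
      ultimately have "cls ` tail ` set (q2 @ [a]) \<subseteq> (\<lambda>a. cls (head a)) ` set as" by auto
      then show ?thesis using p(4) in_set_butlastD[of _ as] by (auto simp: image_subset_iff)
    qed
    have a_new: "cls (head a) \<notin> insert (cls r) ((\<lambda>a. cls (head a)) ` set as)"
      using snoc.prems by (auto simp: dpath_def)
    then have a_tails: "head a \<notin> tail ` set (p @ q2 @ [a])" using tails by auto
    have rt: "rtrail (p @ q2)" using q2(1) by (simp add: rpath_def)
    \<comment> \<open>As \<open>opposite a\<close> is unreachable, the edge could occur only as
      \<open>a\<close>; then \<open>head a\<close> would be \<open>tail a\<close> or the tail of a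
      later edge, although its class is new.\<close>
    have "edge a \<notin> edge ` set (p @ q2)"
    proof
      assume edge_mem: "edge a \<in> edge ` set (p @ q2)"
      have "a \<in> set (p @ q2)"
        using mem_if_edge_mem[OF rt arcsD(1)[OF a] edge_mem arcsD(5)[OF a]] .
      then obtain u1 u2 where u: "p @ q2 = u1 @ a # u2" by (meson split_list)
      show False
      proof (cases "u2 = []")
        case True
        then have "head a = tail a" using q2(2) u by simp
        then show False using tail_neq_head arcsD(1)[OF a] by metis
      next
        case False
        then have "head a = tail (hd u2)"
          using rt by (auto simp: u rtrail_def segment_append segment_Cons link_def)
        moreover have "hd u2 \<in> set (p @ q2)" using False by (simp add: u)
        ultimately show False using a_tails by auto
      qed
    qed
    moreover have "link (last (p @ q2)) a" using q2(2,3) q(2) unfolding link_def by metis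
    ultimately have "rtrail ((p @ q2) @ [a])"
      using rt \<open>tail a \<noteq> r\<close> q2(2) arcsD(1)[OF a] by (intro rtrail_snoc) auto
    then have "rpath (p @ q2 @ [a])"
      using q2(1,2) a_tails by (auto simp: rpath_iff_tails)
    moreover have "lifts (p @ q2 @ [a]) (as @ [a])"
    proof -
      have "b \<in> set as" using False by (simp add: b_def)
      then show ?thesis using p(3) q2(4) unfolding lifts_def by auto
    qed
    ultimately show ?thesis using tails by (intro exI[of _ "p @ q2 @ [a]"]) simp
  qed
qed simp

text \<open>The contracted path leads only to the component of \<open>x\<close>; the final piece of
  \<open>q\<close> is grafted on to end at \<open>x\<close> itself.\<close>

lemma lift_path_to_vertex:
  assumes as: "as \<noteq> []" "set as \<subseteq> arcs" "cpath as (cls x)" and q: "rpath q" "head (last q) = x"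
  shows "\<exists>p. rpath p \<and> head (last p) = x \<and> lifts p as"
proof -
  define b where "b = last as"
  have b: "b \<in> arcs" "as = butlast as @ [b]" using as by (auto simp: b_def)
  have bx: "cls (head b) = cls x"
    using as(3) dwalk_last[where tgt = "\<lambda>a. cls (head a)", OF _ as(1)] unfolding dpath_def b_def by blast
  obtain p where p: "rpath p" "last p = b" "lifts p as"
    "cls ` tail ` set p \<subseteq> insert (cls r) ((\<lambda>a. cls (head a)) ` set (butlast as))"
    using lift_path[OF as] by (auto simp: b_def)
  have "distinct (cls r # map (\<lambda>a. cls (head a)) (butlast as @ [b]))"
    using as(3) b(2) by (simp add: dpath_def)
  then have "cls (head b) \<notin> insert (cls r) ((\<lambda>a. cls (head a)) ` set (butlast as))" by auto
  then have "\<forall>d\<in>set p. (head (last p), tail d) \<notin> conn"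
    using p(2,4) cls_eq_iff by (metis image_eqI subsetD)
  then obtain q2 where q2: "rpath (p @ q2)" "head (last (p @ q2)) = x"
    "\<forall>d\<in>set q2. und_at (head b) \<and> (head b, tail d) \<in> conn \<and> (head b, head d) \<in> conn"
    using rpath_extend_in_component[of p q] p q bx arcsD(3)[OF b(1)] by (auto simp: cls_eq_iff)
  moreover have "b \<in> set as" using as by (simp add: b_def)
  ultimately have "lifts (p @ q2) as" using p(3) unfolding lifts_def by auto
  then show ?thesis using q2 by blast
qed

text \<open>Each edge of a lift is an arc or lies in a nontrivial component entered by one. As
  entries are unique, arc-disjoint contracted paths enter different nontrivial components.\<close>

lemma lifts_edge_disjoint:
  assumes "rpath p" "rpath p'" "lifts p as" "lifts p' as'" "set as \<subseteq> arcs" "set as' \<subseteq> arcs"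
    "set as \<inter> set as' = {}"
  shows "edge_disjoint p p'"
proof -
  \<comment> \<open>An arc inside a component entered by \<open>a\<close> has its head there too, so
    uniqueness of entries identifies it with \<open>a\<close>.\<close>
  have arc_vs_component: False
    if "d \<in> arcs" "a \<in> arcs" "d \<noteq> a" "und_at (head a)" "(head a, tail d') \<in> conn"
      "(head a, head d') \<in> conn" "d' \<in> OE" "edge d = edge d'" for d d' a
  proof -
    have "head d \<in> {tail d', head d'}" using edge_ends_eq[of d d'] that arcsD by auto
    then have "(head a, head d) \<in> conn" using that by auto
    then have "a = d" using entry_unique[of a d] arcsD(2,3) that(1,2,4) by metis
    then show False using that(3) by simp
  qed
  have False if d: "d \<in> set p" "d' \<in> set p'" "edge d = edge d'" for d d'
  proof -
    have OE: "d \<in> OE" "d' \<in> OE" using d assms(1,2) rtrail_OE by (auto simp: rpath_def)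
    have "d \<in> set as \<or> (\<exists>a\<in>set as. und_at (head a) \<and> (head a, tail d) \<in> conn \<and> (head a, head d) \<in> conn)"
      using assms(3) d by (simp add: lifts_def)
    moreover have "d' \<in> set as' \<or> (\<exists>a\<in>set as'. und_at (head a) \<and> (head a, tail d') \<in> conn \<and> (head a, head d') \<in> conn)"
      using assms(4) d by (simp add: lifts_def)
    ultimately consider "d \<in> set as" "d' \<in> set as'"
      | a where "d \<in> set as" "a \<in> set as'" "und_at (head a)" "(head a, tail d') \<in> conn" "(head a, head d') \<in> conn"
      | a where "d' \<in> set as'" "a \<in> set as" "und_at (head a)" "(head a, tail d) \<in> conn" "(head a, head d) \<in> conn"
      | a a' where "a \<in> set as" "a' \<in> set as'" "und_at (head a)" "und_at (head a')"
        "(head a, tail d) \<in> conn" "(head a, head d) \<in> conn"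
        "(head a', tail d') \<in> conn" "(head a', head d') \<in> conn"
      by blast
    then show False
    proof cases
      case 1
      then have "d \<in> arcs" "d' \<in> arcs" using assms(5,6) by auto
      then have "d = d'" using oedge_cases[OF OE d(3)] arcsD(2)[of d] arcsD(5)[of d'] by metis
      then show False using 1 assms(7) by blast
    next
      case 2
      then have "d \<in> arcs" "a \<in> arcs" "d \<noteq> a" using assms(5-7) by auto
      then show False using arc_vs_component[of d a d'] 2 OE(2) d(3) by simp
    next
      case 3
      then have "d' \<in> arcs" "a \<in> arcs" "d' \<noteq> a" using assms(5-7) by auto
      then show False using arc_vs_component[of d' a d] 3 OE(1) d(3) by simp
    next
      case 4
      have "tail d \<in> {tail d', head d'}" using edge_ends_eq[OF OE d(3)] by auto
      then have "(head a', tail d) \<in> conn" using 4 by auto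
      then have "(head a, head a') \<in> conn" using 4 conn_sym conn_trans by blast
      moreover have "a \<in> arcs" "a' \<in> arcs" using 4 assms(5,6) by auto
      ultimately have "a = a'" using entry_unique[of a a'] arcsD(2,3) 4(3) by metis
      then show False using 4 assms(7) by blast
    qed
  qed
  then show ?thesis unfolding edge_disjoint_def by blast
qed

section \<open>Duality between edge-disjoint paths and cuts\<close>

lemma finite_OE: "finite OE"
proof (rule finite_subset)
  show "OE \<subseteq> (\<lambda>(e, u, v). OEdge e u v) ` (edges B \<times> verts B \<times> verts B)"
  proof
    fix a assume a: "a \<in> OE"
    have "(edge a, tail a, head a) \<in> edges B \<times> verts B \<times> verts B"
      using a oedge_edge head_in_verts[of a] head_in_verts[of "opposite a"] by simp
    then show "a \<in> (\<lambda>(e, u, v). OEdge e u v) ` (edges B \<times> verts B \<times> verts B)"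
      by (intro image_eqI[of _ _ "(edge a, tail a, head a)"]) auto
  qed
qed (use finite_edges finite_verts in simp)

lemma delta_path_eq:
  "delta_path B r X = edge ` {a. (\<exists>p. rpath p \<and> last p = a) \<and> head a \<in> X \<and> tail a \<notin> X}"
proof -
  have "a \<in> OE" if "rpath p" "last p = a" for a p
    using that rtrail_OE[of p a] by (auto simp: rpath_def rtrail_def)
  then show ?thesis
    using oedge_edge unfolding delta_path_def rpath_iff_root_path by blast
qed

text \<open>Each path enters \<open>X\<close>, and its prefix up to the entering edge is a path that
  puts this edge into the cut; disjointness makes the choice injective.\<close>

lemma disjoint_paths_le_delta:
  assumes "finite P" "\<forall>p\<in>P. path B r p x" "pairwise edge_disjoint P" "x \<in> X" "r \<notin> X"
  shows "card P \<le> card (delta_path B r X)"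
proof -
  have "\<exists>e. e \<in> edge ` set p \<and> e \<in> delta_path B r X" if "p \<in> P" for p
  proof -
    have px: "path B r p x" using that assms(2) by blast
    then have "p \<noteq> []" using assms(4,5) by (auto simp: path_def trail_def seq_verts_def)
    then have p: "rpath p" "head (last p) = x" using px by (auto simp: rpath_iff)
    then obtain p1 g p2 where g: "p = p1 @ g # p2" "tail g \<notin> X" "head g \<in> X"
      using walk_enters[of p X] assms(4,5) by (auto simp: rpath_def rtrail_def segment_def)
    then have "rpath (p1 @ [g])" using rpath_append_fst[of "p1 @ [g]" p2] p by simp
    then have "edge g \<in> delta_path B r X"
      unfolding delta_path_eq using g by (intro imageI) (auto intro!: exI[of _ "p1 @ [g]"])
    then show ?thesis using g by auto
  qed
  then obtain f where f: "\<And>p. p \<in> P \<Longrightarrow> f p \<in> edge ` set p \<and> f p \<in> delta_path B r X" by metis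
  have "inj_on f P"
    using f assms(3) unfolding inj_on_def pairwise_def edge_disjoint_def by (metis disjoint_iff)
  moreover have "finite (delta_path B r X)"
    using finite_edges by (simp add: delta_path_def)
  ultimately show ?thesis using f by (intro card_inj_on_le[of f]) auto
qed

text \<open>Menger's theorem between the classes of \<open>r\<close> and \<open>x\<close> gives
  contracted paths and a cut of equal size; the paths are lifted and the cut is pulled back along
  \<open>cls\<close>.\<close>

lemma delta_le_disjoint_paths:
  assumes x: "x \<in> verts B" "x \<noteq> r"
  shows "\<exists>P X. finite P \<and> (\<forall>p\<in>P. path B r p x) \<and> pairwise edge_disjoint P
    \<and> x \<in> X \<and> X \<subseteq> verts B - {r} \<and> card (delta_path B r X) \<le> card P"
proof (cases "\<exists>q. rpath q \<and> head (last q) = x")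
  case False
  define X where "X = {v \<in> verts B - {r}. \<not> (\<exists>q. rpath q \<and> head (last q) = v)}"
  have "delta_path B r X = {}" by (auto simp: delta_path_eq X_def)
  then show ?thesis using x False by (intro exI[of _ "{}"] exI[of _ X]) (auto simp: X_def)
next
  case True
  then obtain q where q: "rpath q" "head (last q) = x" by blast
  have "finite arcs" using arcsD(1) finite_OE by (meson finite_subset subsetI)
  moreover have "cls r \<noteq> cls x" using x conn_root by (auto simp: cls_eq_iff)
  ultimately obtain \<P> X where PX: "finite \<P>" "\<forall>as\<in>\<P>. set as \<subseteq> arcs \<and> cpath as (cls x)"
    "pairwise (\<lambda>as as'. set as \<inter> set as' = {}) \<P>" "cls x \<in> X" "cls r \<notin> X"
    "card {a \<in> arcs. cls (tail a) \<notin> X \<and> cls (head a) \<in> X} = card \<P>"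
    using menger_arcs[of arcs "cls r" "cls x" "\<lambda>a. cls (tail a)" "\<lambda>a. cls (head a)"] by blast
  have "\<exists>p. rpath p \<and> head (last p) = x \<and> lifts p as" if "as \<in> \<P>" for as
  proof (rule lift_path_to_vertex[OF _ _ _ q])
    show "set as \<subseteq> arcs" "cpath as (cls x)" using PX(2) that by auto
    then show "as \<noteq> []" using \<open>cls r \<noteq> cls x\<close> by (auto simp: dpath_def)
  qed
  then obtain f where f: "\<And>as. as \<in> \<P> \<Longrightarrow> rpath (f as) \<and> head (last (f as)) = x \<and> lifts (f as) as"
    by metis
  have disj: "edge_disjoint (f as) (f as')" if "as \<in> \<P>" "as' \<in> \<P>" "as \<noteq> as'" for as as'
    using lifts_edge_disjoint[of "f as" "f as'" as as'] f PX(2,3) that by (auto simp: pairwise_def)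
  have ne: "f as \<noteq> []" if "as \<in> \<P>" for as using f[OF that] by (auto simp: rpath_def rtrail_def)
  have "inj_on f \<P>"
  proof (rule inj_onI, rule ccontr)
    fix as as' assume "as \<in> \<P>" "as' \<in> \<P>" "f as = f as'" "as \<noteq> as'"
    then show False using disj[of as as'] ne[of as] by (simp add: edge_disjoint_def)
  qed
  then have card: "card (f ` \<P>) = card \<P>" by (rule card_image)
  have paths: "\<forall>p\<in>f ` \<P>. path B r p x" using f ne by (auto simp: rpath_iff)
  have pw: "pairwise edge_disjoint (f ` \<P>)" using disj by (auto simp: pairwise_def)
  define Y where "Y = {v \<in> verts B. cls v \<in> X}"
  \<comment> \<open>Undirectable edges stay inside a class, so an edge counted for \<open>Y\<close>
    is an arc entering \<open>X\<close> after contraction.\<close>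
  have "delta_path B r Y \<subseteq> edge ` {a \<in> arcs. cls (tail a) \<notin> X \<and> cls (head a) \<in> X}"
  proof -
    have "a \<in> arcs \<and> cls (tail a) \<notin> X \<and> cls (head a) \<in> X"
      if p: "rpath p" "last p = a" and a: "head a \<in> Y" "tail a \<notin> Y" for a p
    proof -
      have "a \<in> OE" using p rtrail_OE[of p a] by (auto simp: rpath_def rtrail_def)
      then have "cls (tail a) \<notin> X" "cls (head a) \<in> X"
        using a head_in_verts[of "opposite a"] by (auto simp: Y_def)
      moreover have "\<not> und (edge a)"
        using calculation conn_edge[OF \<open>a \<in> OE\<close>] cls_eq_iff by metis
      ultimately show ?thesis using p by (auto simp: arcs_def)
    qed
    then show ?thesis unfolding delta_path_eq by blast
  qed
  then have "card (delta_path B r Y) \<le> card (edge ` {a \<in> arcs. cls (tail a) \<notin> X \<and> cls (head a) \<in> X})"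
    using \<open>finite arcs\<close> by (intro card_mono) auto
  also have "\<dots> \<le> card {a \<in> arcs. cls (tail a) \<notin> X \<and> cls (head a) \<in> X}"
    using \<open>finite arcs\<close> by (intro card_image_le) auto
  finally have "card (delta_path B r Y) \<le> card (f ` \<P>)" using PX(6) card by simp
  moreover have "x \<in> Y" "Y \<subseteq> verts B - {r}" using x PX(4,5) by (auto simp: Y_def)
  ultimately show ?thesis using PX(1) paths pw by blast
qed

end

theorem theorem4p3:
  fixes B :: "('v, 'e) bigraph" and r x :: 'v
  assumes "finite_bidirected_graph B"
    and "r \<in> verts B"
    and "edge_clean B r"
    and "x \<in> verts B - {r}"
  shows "lambda_path B r x =
    Min {card (delta_path B r X) | X. x \<in> X \<and> X \<subseteq> verts B - {r}}"
proof -
  interpret finite_bidirected_graph B by fact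
  interpret clean_bigraph B r by unfold_locales fact+
  define S where "S = {card P | P. finite P \<and> P \<subseteq> {p. path B r p x} \<and> pairwise edge_disjoint P}"
  define T where "T = {card (delta_path B r X) | X. x \<in> X \<and> X \<subseteq> verts B - {r}}"
  have le: "s \<le> t" if "s \<in> S" "t \<in> T" for s t
    using that disjoint_paths_le_delta unfolding S_def T_def by blast
  obtain P X where PX: "finite P" "\<forall>p\<in>P. path B r p x" "pairwise edge_disjoint P"
    "x \<in> X" "X \<subseteq> verts B - {r}" "card (delta_path B r X) \<le> card P"
    using delta_le_disjoint_paths[of x] assms(4) by auto
  have s: "card P \<in> S" and t: "card (delta_path B r X) \<in> T"
    using PX unfolding S_def T_def by blast+
  have eq: "card (delta_path B r X) = card P" using le[OF s t] PX(6) by simp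
  \<comment> \<open>The size of any one cut bounds \<open>S\<close>, so its maximum is
    attained.\<close>
  have "finite S" using le[OF _ t] by (meson finite_nat_set_iff_bounded_le)
  then have "Max S = card P" using s t le eq by (intro Max_eqI) auto
  moreover have "T = (\<lambda>X. card (delta_path B r X)) ` {X. x \<in> X \<and> X \<subseteq> verts B - {r}}"
    by (auto simp: T_def)
  then have "finite T" using finite_verts by simp
  then have "Min T = card P" using s t le eq by (intro Min_eqI) auto
  ultimately show ?thesis by (simp add: lambda_path_def S_def T_def)
qed

end
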